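(* Let $\kappa$ be a regular uncountable cardinal, let $\gamma<\kappa$ be a limit ordinal, and let $I$ be a monotone family of subsets of $\kappa$ (that is, a family of subsets of $\kappa$ that is closed under subsets) such that $\kappa$ cannot be written as a union of fewer than $\kappa$ many elements of $I$. Then the following hold. (1) Cut has a winning strategy in $\mathcal U(\kappa,I,\gamma)$ if and only if $\kappa\le 2^{|\gamma|}$. (2) Cut has a winning strategy in $\mathcal U(\kappa,I,{\le}\gamma)$ if and only if $\kappa\le 2^{<\gamma}$. (3) If $\kappa>2^{<\gamma}$, then Cut does not have a winning strategy in $\mathcal U(\kappa,I,{<}\gamma)$. (4) If $I=\mathrm{bd}_\kappa$, then Cut has a winning strategy in $\mathcal U(\kappa,I,{<}\kappa)$ if and only if $\kappa$ is not weakly compact.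
   Context: $\mathrm{bd}_\kappa$ denotes the ideal of bounded subsets of $\kappa$; $I^+$ denotes the collection of subsets of $\kappa$ not in $I$. For a limit ordinal $\gamma$, $2^{<\gamma}=\sup\{2^\delta\mid\delta<\gamma\text{ is a cardinal}\}$. Games between players Cut and Choose: in each round, Cut divides the set $\kappa$ into two disjoint pieces, and Choose answers by picking one of them. (i) $\mathcal U(\kappa,I,\gamma)$ (for $\gamma<\kappa$) has $\gamma$ many rounds; Choose wins if the intersection of all of their choices is in $I^+$, and Cut wins otherwise. (ii) $\mathcal U(\kappa,I,{\le}\gamma)$ (for $\gamma<\kappa$) has $\gamma$ many rounds; Choose wins if for all $\delta<\gamma$ the intersection of their choices up to stage $\delta$ is in $I^+$ and the intersection of all of their $\gamma$ many choices is nonempty; Cut wins otherwise. (iii) $\mathcal U(\kappa,I,{<}\gamma)$ (for $\gamma\le\kappa$) has $\gamma$ many rounds; Choose wins if for all $\delta<\gamma$ the intersection of their first $\delta$ many choices is in $I^+$; Cut wins otherwise.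
   Formalization: In (1) and (2) the "if" directions are stated only for I containing all singletons {x}, x in κ; without this they fail, e.g. for I={∅}, κ=ω₁, γ=ω in (1) and γ=ω+ω in (2), where Choose wins by always keeping a fixed point. *)

theory Defs
  imports Main "HOL-Library.FuncSet" "HOL-Library.Ramsey"
begin

unbundle cardinal_syntax

(* A cardinal kappa is a cardinal order r, with Field r as its underlying set; an ordinal is a
   well-order g. "gamma < kappa" is  g <o r,  and the first delta many rounds, for delta < gamma,
   are the rounds in  underS g d  for the corresponding  d \<in> Field g. *)

definition regular_uncountable :: "'a rel \<Rightarrow> bool" where
  "regular_uncountable r \<longleftrightarrow> Card_order r \<and> natLeq <o r \<and> regularCard r"

definition limit_ordinal :: "'b rel \<Rightarrow> bool" where
  "limit_ordinal g \<longleftrightarrow> Well_order g \<and> Field g \<noteq> {} \<and>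
     (\<forall>x\<in>Field g. \<exists>y\<in>Field g. (x, y) \<in> g \<and> x \<noteq> y)"

definition is_card_sup :: "'c rel set \<Rightarrow> 'c rel \<Rightarrow> bool" where
  "is_card_sup C c \<longleftrightarrow> Card_order c \<and> (\<forall>d\<in>C. d \<le>o c) \<and>
     (\<forall>c'::'c rel. Card_order c' \<and> (\<forall>d\<in>C. d \<le>o c') \<longrightarrow> c \<le>o c')"

(* 2^{<gamma}. Each cardinal delta < gamma is realised on the carrier type of g, so quantifying over
   that type loses nothing. The supremum is determined up to =o, and it exists by the lemma below. *)
definition two_pow_less :: "'b rel \<Rightarrow> ('b \<Rightarrow> bool) rel" where
  "two_pow_less g = (SOME c. is_card_sup {ctwo ^c d | d :: 'b rel. Card_order d \<and> d <o g} c)"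

lemma is_card_sup_two_pow_less:
  fixes g :: "'b rel"
  shows "is_card_sup {ctwo ^c d | d :: 'b rel. Card_order d \<and> d <o g} (two_pow_less g)"
proof -
  define C where "C = {ctwo ^c d | d :: 'b rel. Card_order d \<and> d <o g}"
  define U where "U = {c :: ('b \<Rightarrow> bool) rel. Card_order c \<and> (\<forall>d\<in>C. d \<le>o c)}"
  have "e \<le>o |UNIV :: ('b \<Rightarrow> bool) set|" if e: "e \<in> C" for e
  proof -
    from e obtain d where d: "e = ctwo ^c (d :: 'b rel)"
      unfolding C_def by blast
    show ?thesis
      unfolding d cexp_def
      by (rule card_of_mono1[OF subset_UNIV])
  qed
  then have "|UNIV :: ('b \<Rightarrow> bool) set| \<in> U"
    unfolding U_def using card_of_Card_order by blast
  then obtain c where c: "c \<in> U" and min: "\<And>c'. (c', c) \<in> ordLess \<Longrightarrow> c' \<notin> U"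
    by (rule wfE_min[OF wf_ordLess]) blast
  have "c \<le>o c'" if c': "c' \<in> U" for c'
  proof -
    have "Well_order c" "Well_order c'"
      using c c' unfolding U_def by (simp_all add: card_order_on_well_order_on)
    then show ?thesis
      using min[of c'] c' not_ordLess_iff_ordLeq by blast
  qed
  with c have "is_card_sup C c"
    unfolding is_card_sup_def U_def by blast
  then show ?thesis
    unfolding two_pow_less_def C_def by (rule someI)
qed

definition monotone_family :: "'a set \<Rightarrow> 'a set set \<Rightarrow> bool" where
  "monotone_family K I \<longleftrightarrow> I \<subseteq> Pow K \<and> (\<forall>X\<in>I. \<forall>Y. Y \<subseteq> X \<longrightarrow> Y \<in> I)"

definition bd :: "'a rel \<Rightarrow> 'a set set" where
  "bd r = {X. X \<subseteq> Field r \<and> (\<exists>a\<in>Field r. \<forall>x\<in>X. (x, a) \<in> r)}"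

definition positive :: "'a set \<Rightarrow> 'a set set \<Rightarrow> 'a set set" where
  "positive K I = Pow K - I"

(* Weak compactness in the form kappa \<rightarrow> (kappa)^2_2; colourings are total functions on sets, of which
   only the values on two-element subsets of kappa matter. *)
definition weakly_compact :: "'a rel \<Rightarrow> bool" where
  "weakly_compact r \<longleftrightarrow> Card_order r \<and> natLeq <o r \<and>
     (\<forall>f :: 'a set \<Rightarrow> bool. \<exists>H \<subseteq> Field r. |H| =o r \<and> (\<exists>b. \<forall>X\<in>nsets H 2. f X = b))"

(* A round is ((A, B), C): Cut divides K into A and B, and Choose picks C. Cut may leave a piece
   empty. The rounds of a play are indexed by the field of a well-order g. *)
type_synonym ('b, 'a) play = "'b \<Rightarrow> ('a set \<times> 'a set) \<times> 'a set"

definition cuts :: "'a set \<Rightarrow> ('a set \<times> 'a set) set" where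
  "cuts K = {(A, B). A \<union> B = K \<and> A \<inter> B = {}}"

definition is_play :: "'a set \<Rightarrow> 'b rel \<Rightarrow> ('b, 'a) play \<Rightarrow> bool" where
  "is_play K g p \<longleftrightarrow> (\<forall>i\<in>Field g. fst (p i) \<in> cuts K \<and>
     snd (p i) \<in> {fst (fst (p i)), snd (fst (p i))})"

(* A strategy gives Cut's move in round i, as a function of all the moves made before round i. *)
type_synonym ('b, 'a) cut_strategy = "'b \<Rightarrow> ('b, 'a) play \<Rightarrow> 'a set \<times> 'a set"

definition is_cut_strategy :: "'a set \<Rightarrow> 'b rel \<Rightarrow> ('b, 'a) cut_strategy \<Rightarrow> bool" where
  "is_cut_strategy K g \<sigma> \<longleftrightarrow> (\<forall>i\<in>Field g. \<forall>h. \<sigma> i h \<in> cuts K)"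

definition follows :: "'b rel \<Rightarrow> ('b, 'a) cut_strategy \<Rightarrow> ('b, 'a) play \<Rightarrow> bool" where
  "follows g \<sigma> p \<longleftrightarrow> (\<forall>i\<in>Field g. fst (p i) = \<sigma> i (restrict p (underS g i)))"

definition Cut_has_ws :: "'a set \<Rightarrow> 'b rel \<Rightarrow> (('b, 'a) play \<Rightarrow> bool) \<Rightarrow> bool" where
  "Cut_has_ws K g choose_wins \<longleftrightarrow>
     (\<exists>\<sigma>. is_cut_strategy K g \<sigma> \<and> (\<forall>p. is_play K g p \<and> follows g \<sigma> p \<longrightarrow> \<not> choose_wins p))"

(* The intersection of the choices made in the rounds in R; it is K if R is empty. *)
definition choices_Int :: "'a set \<Rightarrow> ('b, 'a) play \<Rightarrow> 'b set \<Rightarrow> 'a set" where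
  "choices_Int K p R = K \<inter> (\<Inter>i\<in>R. snd (p i))"

(* The winning conditions for Choose in U(K,I,gamma), U(K,I,\<le>gamma) and U(K,I,<gamma). *)

definition choose_wins_eq :: "'a set \<Rightarrow> 'a set set \<Rightarrow> 'b rel \<Rightarrow> ('b, 'a) play \<Rightarrow> bool" where
  "choose_wins_eq K I g p \<longleftrightarrow> choices_Int K p (Field g) \<in> positive K I"

definition choose_wins_le :: "'a set \<Rightarrow> 'a set set \<Rightarrow> 'b rel \<Rightarrow> ('b, 'a) play \<Rightarrow> bool" where
  "choose_wins_le K I g p \<longleftrightarrow> (\<forall>d\<in>Field g. choices_Int K p (underS g d) \<in> positive K I) \<and>
     choices_Int K p (Field g) \<noteq> {}"

definition choose_wins_less :: "'a set \<Rightarrow> 'a set set \<Rightarrow> 'b rel \<Rightarrow> ('b, 'a) play \<Rightarrow> bool" where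
  "choose_wins_less K I g p \<longleftrightarrow> (\<forall>d\<in>Field g. choices_Int K p (underS g d) \<in> positive K I)"

end

theory Submission
  imports Defs
begin

text \<open>
  Fix a strategy \<open>\<sigma>\<close> of Cut and let every point \<open>x\<close> of \<open>\<kappa>\<close> direct a play against \<open>\<sigma>\<close>: Choose always
  picks the piece that contains \<open>x\<close>. Then \<open>x\<close> lies in all intersections that arise, so the positions
  reached after a given initial segment \<open>R\<close> of rounds cover \<open>\<kappa>\<close>; and as \<open>\<sigma>\<close> is fixed, such a position
  is determined by the subset of \<open>R\<close> that records which of the two pieces was picked. If \<open>\<sigma>\<close> wins, each of
  these plays runs into a member of \<open>I\<close>, and \<open>\<kappa>\<close> is covered by that many members of \<open>I\<close>: at most
  \<open>2^|\<gamma>|\<close> when only the end of the play counts, and at most the sum of the \<open>2^|\<delta>|\<close> for \<open>\<delta> < \<gamma>\<close> when Cut has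
  to win earlier (\<open>cover_by_losing_positions\<close>). In the \<open>\<le>\<gamma>\<close> game Cut does have to win earlier, because
  \<open>x\<close> itself keeps the last intersection nonempty. The assumption on unions of members of \<open>I\<close> now
  bounds \<open>\<kappa>\<close> from above.

  Conversely, if \<open>\<kappa> \<le> 2^|R|\<close>, Cut labels the points by distinct subsets of \<open>R\<close> and asks in round \<open>i\<close>
  whether \<open>i\<close> belongs to the label; after the rounds in \<open>R\<close> at most one point is left
  (\<open>separating_strategy\<close>), and such a set is in \<open>I\<close> once the singletons are. Regularity of \<open>\<kappa>\<close> makes this apply to \<open>2^{<\<gamma>}\<close>: fewer than \<open>\<kappa>\<close> many
  cardinals below \<open>\<kappa>\<close> have their supremum below \<open>\<kappa>\<close>, so \<open>\<kappa> \<le> 2^{<\<gamma>}\<close> already means \<open>\<kappa> \<le> 2^|\<delta>|\<close> for some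
  single \<open>\<delta> < \<gamma>\<close> (\<open>ordLeq_two_pow_less_iff\<close>). The \<open><\<gamma>\<close> game is easier for Choose than the \<open>\<le>\<gamma>\<close> game.

  For the game of length \<open>\<kappa>\<close> on the bounded ideal, a colouring of pairs gives a strategy: in round \<open>i\<close>
  Cut takes a point \<open>a_i \<ge> i\<close> of the current intersection and splits \<open>\<kappa>\<close> by the colour of \<open>{a_i, y}\<close>.
  If Choose survived, the \<open>a_i\<close> at which the same colour was picked, for the colour picked cofinally
  often, would form a homogeneous set of size \<open>\<kappa>\<close>. In the other direction, colour a pair
  \<open>x < y\<close> by the lexicographic comparison of the choices made for \<open>x\<close> and for \<open>y\<close> against \<open>\<sigma>\<close>. Along a
  homogeneous set \<open>H\<close> of size \<open>\<kappa>\<close> these choice sequences are monotone, so by induction and regularity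
  each of their entries is eventually constant; the limit sequence is a play whose intersections
  before round \<open>\<kappa>\<close> contain end segments of \<open>H\<close>, and Choose wins it.
\<close>

section \<open>Cardinal arithmetic\<close>

lemma ctwo_cexp_ordIso_Pow: "ctwo ^c d =o |Pow (Field d)|"
proof -
  have "|Pow (Field d)| =o |Func (Field d) (UNIV :: bool set)|"
    by (rule card_of_Pow_Func)
  then show ?thesis
    by (simp add: cexp_def ctwo_def Field_card_of ordIso_symmetric)
qed

lemma Pow_ordLeq_mono:
  assumes "|A| \<le>o |B|"
  shows "|Pow A| \<le>o |Pow B|"
proof -
  obtain e where e: "inj_on e A" "e ` A \<subseteq> B"
    using assms card_of_ordLeq[of A B] by blast
  then have "inj_on (image e) (Pow A)" "image e ` Pow A \<subseteq> Pow B"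
    by (auto intro: inj_on_image_Pow)
  then show ?thesis
    using card_of_ordLeq[of "Pow A" "Pow B"] by blast
qed

lemma underS_subset_Field: "underS g d \<subseteq> Field g"
  by (auto simp: underS_def Field_def)

lemma regular_uncountable_Card_order: "regular_uncountable r \<Longrightarrow> Card_order r"
  by (simp add: regular_uncountable_def)

lemma regular_uncountable_infinite_Field:
  assumes "regular_uncountable r"
  shows "infinite (Field r)"
proof
  assume "finite (Field r)"
  moreover have "|Field r| =o r"
    using assms card_of_Field_ordIso by (auto simp: regular_uncountable_def)
  moreover have "natLeq <o r"
    using assms by (auto simp: regular_uncountable_def)
  ultimately have "natLeq <o |Field r|"
    using ordIso_symmetric ordLess_ordIso_trans by blast
  then have "|UNIV :: nat set| \<le>o |Field r|"
    using card_of_nat ordIso_ordLeq_trans ordLess_imp_ordLeq by blast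
  with \<open>finite (Field r)\<close> show False
    using card_of_ordLeq_infinite infinite_UNIV_nat by blast
qed

lemma regular_uncountable_stable:
  assumes "regular_uncountable r"
  shows "stable r"
  using assms regularCard_stable regular_uncountable_infinite_Field
  by (auto simp: regular_uncountable_def)

lemma not_cofinal_iff_bounded:
  assumes "Well_order r" "A \<subseteq> Field r"
  shows "\<not> cofinal A r \<longleftrightarrow> (\<exists>a\<in>Field r. \<forall>x\<in>A. (x, a) \<in> r)"
proof -
  interpret wo_rel r
    by unfold_locales (fact assms(1))
  have "(b, a) \<in> r \<longleftrightarrow> a = b \<or> (a, b) \<notin> r" if "a \<in> Field r" "b \<in> Field r" for a b
    using that TOTALS ANTISYM REFL by (auto simp: antisym_def refl_on_def)
  then show ?thesis
    using assms(2) unfolding cofinal_def by (meson subsetD)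
qed

lemma positive_bd_iff_cofinal:
  assumes "Well_order r"
  shows "X \<in> positive (Field r) (bd r) \<longleftrightarrow> X \<subseteq> Field r \<and> cofinal X r"
  using not_cofinal_iff_bounded[OF assms, of X] by (auto simp: positive_def bd_def)

lemma small_imp_bounded:
  assumes "regular_uncountable r" "A \<subseteq> Field r" "|A| <o r"
  obtains a where "a \<in> Field r" "\<forall>x\<in>A. (x, a) \<in> r"
proof -
  have "\<not> cofinal A r"
    using assms not_ordLess_ordIso by (auto simp: regular_uncountable_def regularCard_def)
  then show ?thesis
    using not_cofinal_iff_bounded[of r A] assms that
    by (auto simp: regular_uncountable_def card_order_on_def)
qed

lemma full_size_imp_cofinal:
  assumes "Card_order r" "infinite (Field r)" "A \<subseteq> Field r" "|A| =o r"
  shows "cofinal A r"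
proof (rule ccontr)
  assume "\<not> cofinal A r"
  then obtain a where a: "a \<in> Field r" "\<forall>x\<in>A. (x, a) \<in> r"
    using assms not_cofinal_iff_bounded[of r A] by (auto simp: card_order_on_def)
  then obtain b where b: "b \<in> Field r" "a \<noteq> b" "(a, b) \<in> r"
    using infinite_Card_order_limit[OF assms(1,2), of a] by blast
  have "Well_order r"
    using assms(1) by (auto simp: card_order_on_def)
  then have "A \<subseteq> underS r b"
    using a b unfolding underS_def order_on_defs
    by (blast dest: transD antisymD)
  then have "|A| <o r"
    using card_of_underS[OF assms(1) b(1)] card_of_mono1 ordLeq_ordLess_trans by blast
  then show False
    using assms(4) not_ordLess_ordIso by blast
qed

lemma ordLess_iff_not_ordLeq_card:
  assumes "Card_order r"
  shows "|A| <o r \<longleftrightarrow> \<not> r \<le>o |A|"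
proof -
  have "Well_order r"
    using assms by (simp add: card_order_on_def)
  then show ?thesis
    using not_ordLeq_iff_ordLess[of "|A|" r] card_of_Well_order[of A] by blast
qed

lemma card_underS_ordLess:
  assumes "Well_order g" "d \<in> Field g"
  shows "|underS g d| <o g"
proof -
  have 1: "Restr g (underS g d) <o g"
    using assms ordLess_iff_ordIso_Restr[of g "Restr g (underS g d)"]
      Well_order_Restr ordIso_reflexive by blast
  have "well_order_on (underS g d) (Restr g (underS g d))"
    using assms well_order_on_Restr underS_subset_Field by metis
  then have "|underS g d| \<le>o Restr g (underS g d)"
    by (rule card_of_least)
  with 1 show ?thesis
    using ordLeq_ordLess_trans by blast
qed

lemma ordLess_imp_ordIso_underS:
  assumes "Well_order g" "d <o g"
  obtains e where "e \<in> Field g" "|Field d| =o |underS g e|"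
proof -
  have "Well_order d"
    using assms(2) by (simp add: ordLess_def)
  then obtain e where e: "e \<in> Field g" "d =o Restr g (underS g e)"
    using assms ordLess_iff_ordIso_Restr[of g d] by blast
  have "Field (Restr g (underS g e)) = underS g e"
    using assms(1) well_order_on_Restr underS_subset_Field well_order_on_Field
    by metis
  then show ?thesis
    using that e card_of_cong by metis
qed

lemma Pow_underS_ordLeq_two_pow_less:
  fixes g :: "'b rel"
  assumes "Well_order g" "d \<in> Field g"
  shows "|Pow (underS g d)| \<le>o two_pow_less g"
proof -
  have "ctwo ^c |underS g d| \<le>o two_pow_less g"
    using is_card_sup_two_pow_less[of g] card_underS_ordLess[OF assms] card_of_Card_order
    unfolding is_card_sup_def by blast
  then show ?thesis
    using ctwo_cexp_ordIso_Pow[of "|underS g d|"] ordIso_symmetric ordIso_ordLeq_trans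
    by (fastforce simp: Field_card_of)
qed

lemma Sigma_Pow_underS_ordLess:
  assumes r: "regular_uncountable r" and g: "g <o r"
    and small: "\<forall>d\<in>Field g. |Pow (underS g d)| <o r"
  shows "|Sigma (underS g ` Field g) Pow| <o r"
proof -
  have "|Field g| \<le>o g"
    using g card_of_least by (auto simp: ordLess_def)
  then have "|underS g ` Field g| <o r"
    using card_of_image g ordLeq_ordLess_trans ordLeq_transitive by metis
  then show ?thesis
    using small by (intro stable_elim[OF regular_uncountable_stable[OF r]]) auto
qed

text \<open>
  The supremum \<open>2^{<\<gamma>}\<close> is taken over fewer than \<open>\<kappa>\<close> many cardinals; were they all below \<open>\<kappa>\<close>, their
  disjoint sum would be an upper bound that is still below \<open>\<kappa>\<close>, by regularity.
\<close>

lemma ordLeq_two_pow_less_iff: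
  fixes r :: "'a rel" and g :: "'b rel"
  assumes r: "regular_uncountable r" and g: "Well_order g" "g <o r"
  shows "r \<le>o two_pow_less g \<longleftrightarrow> (\<exists>d\<in>Field g. r \<le>o |Pow (underS g d)| )"
proof
  assume "\<exists>d\<in>Field g. r \<le>o |Pow (underS g d)|"
  then show "r \<le>o two_pow_less g"
    using Pow_underS_ordLeq_two_pow_less[OF g(1)] ordLeq_transitive by blast
next
  assume le: "r \<le>o two_pow_less g"
  have Card: "Card_order r"
    and sup: "is_card_sup {ctwo ^c d | d :: 'b rel. Card_order d \<and> d <o g} (two_pow_less g)"
    using r is_card_sup_two_pow_less by (auto simp: regular_uncountable_def)
  show "\<exists>d\<in>Field g. r \<le>o |Pow (underS g d)|"
  proof (rule ccontr)
    define S where "S = Sigma (underS g ` Field g) Pow"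
    assume "\<not> ?thesis"
    then have less: "|S| <o r"
      unfolding S_def using Sigma_Pow_underS_ordLess[OF r g(2)]
      by (simp add: ordLess_iff_not_ordLeq_card[OF Card])
    \<comment> \<open>The supremum is least only among cardinals on its own type, so \<open>S\<close> is copied there.\<close>
    have "|S| \<le>o two_pow_less g"
      using less le ordLess_imp_ordLeq ordLeq_transitive by blast
    then obtain S' :: "('b \<Rightarrow> bool) set" where S': "|S| =o |S'|"
      using internalize_card_of_ordLeq[of S "two_pow_less g"] by blast
    have "ctwo ^c d \<le>o |S'|" if d: "d <o g" for d :: "'b rel"
    proof -
      obtain e where e: "e \<in> Field g" "|Field d| =o |underS g e|"
        using ordLess_imp_ordIso_underS[OF g(1) d] by blast
      have "|Pow (Field d)| \<le>o |Pow (underS g e)|"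
        using e(2) Pow_ordLeq_mono ordIso_imp_ordLeq by blast
      moreover have "|Pow (underS g e)| \<le>o |S|"
      proof (rule surj_imp_ordLeq)
        show "Pow (underS g e) \<subseteq> snd ` S"
        proof
          fix T assume "T \<in> Pow (underS g e)"
          then have "(underS g e, T) \<in> S"
            using e(1) by (simp add: S_def)
          then show "T \<in> snd ` S"
            by (rule rev_image_eqI) simp
        qed
      qed
      ultimately show ?thesis
        using ordIso_ordLeq_trans[OF ctwo_cexp_ordIso_Pow
            ordLeq_ordIso_trans[OF ordLeq_transitive S']] by blast
    qed
    then have "two_pow_less g \<le>o |S'|"
      using sup card_of_Card_order unfolding is_card_sup_def by blast
    then have "r \<le>o |S|"
      using ordLeq_ordIso_trans[OF ordLeq_transitive[OF le] ordIso_symmetric[OF S']] by blast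
    then show False
      using less ordLess_iff_not_ordLeq_card[OF Card] by blast
  qed
qed

section \<open>Plays steered by a point\<close>

text \<open>
  Choose stays with the piece that contains \<open>x\<close>. Both the strategy and the choice look back only at
  the rounds below \<open>i\<close>, whence the recursion along \<open>g\<close>.
\<close>

definition play_toward :: "'b rel \<Rightarrow> ('b, 'a) cut_strategy \<Rightarrow> 'a \<Rightarrow> ('b, 'a) play" where
  "play_toward g \<sigma> x = wfrec (g - Id)
     (\<lambda>p i. let c = \<sigma> i (restrict p (underS g i)) in (c, if x \<in> fst c then fst c else snd c))"

lemma play_toward_unfold:
  fixes g :: "'b rel" and \<sigma> :: "('b, 'a) cut_strategy"
  assumes "Well_order g"
  shows "play_toward g \<sigma> x i =
    (let c = \<sigma> i (restrict (play_toward g \<sigma> x) (underS g i))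
     in (c, if x \<in> fst c then fst c else snd c))"
proof -
  have "wf (g - Id)"
    using assms by (simp add: well_order_on_def)
  moreover have "restrict (cut p (g - Id) i) (underS g i) = restrict p (underS g i)"
    for p :: "('b, 'a) play"
    by (auto simp: restrict_def cut_def underS_def)
  ultimately show ?thesis
    unfolding play_toward_def by (subst wfrec) simp_all
qed

lemma fst_play_toward:
  assumes "Well_order g"
  shows "fst (play_toward g \<sigma> x i) = \<sigma> i (restrict (play_toward g \<sigma> x) (underS g i))"
  by (subst play_toward_unfold[OF assms]) (simp add: Let_def)

lemma snd_play_toward:
  assumes "Well_order g"
  shows "snd (play_toward g \<sigma> x i) = (if x \<in> fst (fst (play_toward g \<sigma> x i))
    then fst (fst (play_toward g \<sigma> x i)) else snd (fst (play_toward g \<sigma> x i)))"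
  unfolding fst_play_toward[OF assms]
  by (subst play_toward_unfold[OF assms]) (simp add: Let_def)

lemma follows_play_toward:
  assumes "Well_order g"
  shows "follows g \<sigma> (play_toward g \<sigma> x)"
  by (simp add: follows_def fst_play_toward[OF assms])

lemma fst_play_toward_in_cuts:
  assumes "Well_order g" "is_cut_strategy K g \<sigma>" "i \<in> Field g"
  shows "fst (play_toward g \<sigma> x i) \<in> cuts K"
  using assms by (simp add: fst_play_toward is_cut_strategy_def)

lemma is_play_play_toward:
  assumes "Well_order g" "is_cut_strategy K g \<sigma>"
  shows "is_play K g (play_toward g \<sigma> x)"
  unfolding is_play_def
proof
  fix i assume "i \<in> Field g"
  then show "fst (play_toward g \<sigma> x i) \<in> cuts K \<and> snd (play_toward g \<sigma> x i) \<in>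
    {fst (fst (play_toward g \<sigma> x i)), snd (fst (play_toward g \<sigma> x i))}"
    using fst_play_toward_in_cuts[OF assms, of i x] by (simp add: snd_play_toward[OF assms(1)])
qed

lemma mem_snd_play_toward:
  assumes "Well_order g" "is_cut_strategy K g \<sigma>" "i \<in> Field g" "x \<in> K"
  shows "x \<in> snd (play_toward g \<sigma> x i)"
  using fst_play_toward_in_cuts[OF assms(1-3), of x] assms(4)
  by (auto simp: snd_play_toward[OF assms(1)] cuts_def)

lemma mem_choices_Int_play_toward:
  assumes "Well_order g" "is_cut_strategy K g \<sigma>" "R \<subseteq> Field g" "x \<in> K"
  shows "x \<in> choices_Int K (play_toward g \<sigma> x) R"
  using mem_snd_play_toward[OF assms(1,2) _ assms(4)] assms(3,4)
  by (auto simp: choices_Int_def)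

definition choice_pattern :: "'b rel \<Rightarrow> ('b, 'a) cut_strategy \<Rightarrow> 'a \<Rightarrow> 'b set" where
  "choice_pattern g \<sigma> x = {i. x \<in> fst (fst (play_toward g \<sigma> x i))}"

lemma play_toward_step_cong:
  assumes "Well_order g"
    and "\<forall>j\<in>underS g i. play_toward g \<sigma> x j = play_toward g \<sigma> y j"
    and "i \<in> choice_pattern g \<sigma> x \<longleftrightarrow> i \<in> choice_pattern g \<sigma> y"
  shows "play_toward g \<sigma> x i = play_toward g \<sigma> y i"
proof -
  have "restrict (play_toward g \<sigma> x) (underS g i) = restrict (play_toward g \<sigma> y) (underS g i)"
    using assms(2) by (auto simp: restrict_def)
  then have "fst (play_toward g \<sigma> x i) = fst (play_toward g \<sigma> y i)"
    by (simp add: fst_play_toward[OF assms(1)])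
  then show ?thesis
    using assms(3) by (intro prod_eqI) (simp_all add: choice_pattern_def snd_play_toward[OF assms(1)])
qed

text \<open>
  Against a fixed strategy nothing but the choices of Choose varies, so one bit per round encodes a
  play. This is where the powers of two come from.
\<close>

lemma play_toward_determined_by_pattern:
  assumes g: "Well_order g"
    and R: "\<forall>i\<in>R. underS g i \<subseteq> R"
    and eq: "choice_pattern g \<sigma> x \<inter> R = choice_pattern g \<sigma> y \<inter> R"
    and i: "i \<in> R"
  shows "play_toward g \<sigma> x i = play_toward g \<sigma> y i"
proof -
  have "wf (g - Id)"
    using g by (simp add: well_order_on_def)
  then show ?thesis
    using i
  proof (induction i)
    case (less i)
    have "play_toward g \<sigma> x j = play_toward g \<sigma> y j" if "j \<in> underS g i" for j
      using less that R by (auto simp: underS_def)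
    then show ?case
      using eq less.prems by (intro play_toward_step_cong[OF g]) blast+
  qed
qed

text \<open>
  The union of all positions \<open>pos x R\<close> that lie in \<open>I\<close> is the whole board, since \<open>x \<in> pos x R\<close>. Each
  of them is coded by the segment \<open>R\<close> and the subset of \<open>R\<close> of rounds in which the first piece was
  picked, so there are at most as many as there are such pairs. The family \<open>\<R>\<close> collects the stages at
  which Choose can lose: the end of the play alone, or all proper initial segments.
\<close>

lemma cover_by_losing_positions:
  assumes r: "Card_order r" and g: "Well_order g"
    and I_union: "\<not> (\<exists>F. F \<subseteq> I \<and> |F| <o r \<and> \<Union>F = Field r)"
    and \<sigma>: "is_cut_strategy (Field r) g \<sigma>"
    and segments: "\<forall>R\<in>\<R>. R \<subseteq> Field g \<and> (\<forall>i\<in>R. underS g i \<subseteq> R)"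
    and lost: "\<forall>x\<in>Field r. \<exists>R\<in>\<R>. choices_Int (Field r) (play_toward g \<sigma> x) R \<notin> positive (Field r) I"
  shows "r \<le>o |Sigma \<R> Pow|"
proof (rule ccontr)
  assume not_le: "\<not> ?thesis"
  define pos where "pos x R = choices_Int (Field r) (play_toward g \<sigma> x) R" for x R
  define F where "F = {pos x R | x R. x \<in> Field r \<and> R \<in> \<R> \<and> pos x R \<in> I}"
  \<comment> \<open>A position depends on \<open>x\<close> only through its pattern, so \<open>x\<close> may be replaced by a representative.\<close>
  define rep where "rep R S = (SOME x. x \<in> Field r \<and> choice_pattern g \<sigma> x \<inter> R = S)" for R S
  have "pos x R = pos (rep R (choice_pattern g \<sigma> x \<inter> R)) R" if "x \<in> Field r" "R \<in> \<R>" for x R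
  proof -
    define y where "y = rep R (choice_pattern g \<sigma> x \<inter> R)"
    have "y \<in> Field r \<and> choice_pattern g \<sigma> y \<inter> R = choice_pattern g \<sigma> x \<inter> R"
      unfolding y_def rep_def by (rule someI[of _ x]) (use that in blast)
    then have "play_toward g \<sigma> x i = play_toward g \<sigma> y i" if "i \<in> R" for i
      using that segments \<open>R \<in> \<R>\<close>
      by (intro play_toward_determined_by_pattern[OF g, of R]) auto
    then show ?thesis
      unfolding y_def[symmetric] pos_def choices_Int_def by auto
  qed
  then have "F \<subseteq> (\<lambda>(R, S). pos (rep R S) R) ` Sigma \<R> Pow"
    unfolding F_def by fastforce
  then have "|F| \<le>o |Sigma \<R> Pow|"
    by (rule surj_imp_ordLeq)
  then have "|F| <o r"
    using not_le ordLess_iff_not_ordLeq_card[OF r] ordLeq_ordLess_trans by blast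
  moreover have "x \<in> \<Union>F" if x: "x \<in> Field r" for x
  proof -
    obtain R where R: "R \<in> \<R>" "pos x R \<in> I"
      using lost x unfolding pos_def positive_def choices_Int_def by auto
    have "x \<in> pos x R"
      unfolding pos_def using mem_choices_Int_play_toward[OF g \<sigma>] segments R x by blast
    then show ?thesis
      using R x unfolding F_def by blast
  qed
  moreover have "F \<subseteq> I" "\<Union>F \<subseteq> Field r"
    unfolding F_def pos_def choices_Int_def by auto
  ultimately show False
    using I_union by blast
qed

section \<open>Games of length below \<open>\<kappa>\<close>\<close>

lemma subset_singleton_imp_not_positive:
  assumes "monotone_family K I" "{x} \<in> I" "X \<subseteq> {x}"
  shows "X \<notin> positive K I"
  using assms by (auto simp: monotone_family_def positive_def)

text \<open>
  With points labelled injectively by subsets of \<open>R\<close>, the cut in round \<open>i\<close> reveals one bit of the label,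
  so that two points that survive all rounds in \<open>R\<close> have the same label.
\<close>

lemma separating_strategy:
  assumes r: "Card_order r" "Field r \<noteq> {}" and le: "r \<le>o |Pow R|"
    and R: "R \<subseteq> Field g"
  obtains \<sigma> :: "('b, 'a) cut_strategy" where "is_cut_strategy (Field r) g \<sigma>"
    "\<And>p. is_play (Field r) g p \<Longrightarrow> follows g \<sigma> p \<Longrightarrow>
       \<exists>x\<in>Field r. choices_Int (Field r) p R \<subseteq> {x}"
proof -
  have "|Field r| \<le>o |Pow R|"
    using r(1) le card_of_Field_ordIso ordIso_ordLeq_trans by blast
  then obtain e where e: "inj_on e (Field r)" "e ` Field r \<subseteq> Pow R"
    using card_of_ordLeq[of "Field r" "Pow R"] by blast
  define \<sigma> :: "('b, 'a) cut_strategy"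
    where "\<sigma> = (\<lambda>i h. ({x\<in>Field r. i \<in> e x}, {x\<in>Field r. i \<notin> e x}))"
  have "\<exists>x\<in>Field r. choices_Int (Field r) p R \<subseteq> {x}"
    if p: "is_play (Field r) g p" "follows g \<sigma> p" for p
  proof -
    have "x = y" if x: "x \<in> choices_Int (Field r) p R" and y: "y \<in> choices_Int (Field r) p R" for x y
    proof -
      have "i \<in> e x \<longleftrightarrow> i \<in> e y" if "i \<in> R" for i
      proof -
        have "snd (p i) \<in> {{x\<in>Field r. i \<in> e x}, {x\<in>Field r. i \<notin> e x}}"
          using that p R by (auto simp: is_play_def follows_def \<sigma>_def)
        moreover have "x \<in> snd (p i)" "y \<in> snd (p i)"
          using x y that by (auto simp: choices_Int_def)
        ultimately show ?thesis
          by auto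
      qed
      moreover have "x \<in> Field r" "y \<in> Field r"
        using x y by (auto simp: choices_Int_def)
      ultimately show ?thesis
        using e by (intro inj_onD[OF e(1)]) blast+
    qed
    moreover have "choices_Int (Field r) p R \<subseteq> Field r"
      by (simp add: choices_Int_def)
    ultimately show ?thesis
      using r(2) by blast
  qed
  moreover have "is_cut_strategy (Field r) g \<sigma>"
    by (auto simp: is_cut_strategy_def cuts_def \<sigma>_def)
  ultimately show ?thesis
    using that by blast
qed

context
  fixes r :: "'a rel" and g :: "'b rel" and I :: "'a set set"
  assumes r: "regular_uncountable r"
    and g: "Well_order g" "g <o r"
    and I_union: "\<not> (\<exists>F. F \<subseteq> I \<and> |F| <o r \<and> \<Union>F = Field r)"
begin

lemma Cut_ws_eq_imp_ordLeq:
  assumes "Cut_has_ws (Field r) g (choose_wins_eq (Field r) I g)"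
  shows "r \<le>o |Pow (Field g)|"
proof -
  obtain \<sigma> where \<sigma>: "is_cut_strategy (Field r) g \<sigma>"
    and win: "\<And>p. is_play (Field r) g p \<Longrightarrow> follows g \<sigma> p \<Longrightarrow> \<not> choose_wins_eq (Field r) I g p"
    using assms unfolding Cut_has_ws_def by blast
  have "r \<le>o |Sigma {Field g} Pow|"
  proof (rule cover_by_losing_positions[OF regular_uncountable_Card_order[OF r] g(1) I_union \<sigma>])
    show "\<forall>x\<in>Field r. \<exists>R\<in>{Field g}.
        choices_Int (Field r) (play_toward g \<sigma> x) R \<notin> positive (Field r) I"
      using win[OF is_play_play_toward[OF g(1) \<sigma>] follows_play_toward[OF g(1)]]
      by (simp add: choose_wins_eq_def)
  qed (use underS_subset_Field in fastforce)
  moreover have "|Sigma {Field g} Pow| \<le>o |Pow (Field g)|"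
    by (rule surj_imp_ordLeq[of _ "Pair (Field g)"]) auto
  ultimately show ?thesis
    using ordLeq_transitive by blast
qed

text \<open>
  A play directed by a point is never lost at its end, where that point is left. Hence Cut wins it at
  a proper initial segment, and the sum of the corresponding powers of two reaches \<open>\<kappa>\<close>. By regularity
  one summand does.
\<close>

lemma Cut_ws_le_imp_ordLeq:
  assumes "Cut_has_ws (Field r) g (choose_wins_le (Field r) I g)"
  shows "r \<le>o two_pow_less g"
proof -
  obtain \<sigma> where \<sigma>: "is_cut_strategy (Field r) g \<sigma>"
    and win: "\<And>p. is_play (Field r) g p \<Longrightarrow> follows g \<sigma> p \<Longrightarrow> \<not> choose_wins_le (Field r) I g p"
    using assms unfolding Cut_has_ws_def by blast
  have trans: "trans g"
    using g(1) by (simp add: order_on_defs)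
  have antisym: "antisym g"
    using g(1) by (simp add: order_on_defs)
  have "r \<le>o |Sigma (underS g ` Field g) Pow|"
  proof (rule cover_by_losing_positions[OF regular_uncountable_Card_order[OF r] g(1) I_union \<sigma>])
    show "\<forall>R\<in>underS g ` Field g. R \<subseteq> Field g \<and> (\<forall>i\<in>R. underS g i \<subseteq> R)"
      using trans antisym underS_subset_Field[of g]
      by (auto simp: underS_def dest: transD antisymD)
    show "\<forall>x\<in>Field r. \<exists>R\<in>underS g ` Field g.
        choices_Int (Field r) (play_toward g \<sigma> x) R \<notin> positive (Field r) I"
    proof
      fix x assume x: "x \<in> Field r"
      have "choices_Int (Field r) (play_toward g \<sigma> x) (Field g) \<noteq> {}"
        using mem_choices_Int_play_toward[OF g(1) \<sigma> subset_refl x] by blast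
      then show "\<exists>R\<in>underS g ` Field g.
          choices_Int (Field r) (play_toward g \<sigma> x) R \<notin> positive (Field r) I"
        using win[OF is_play_play_toward[OF g(1) \<sigma>] follows_play_toward[OF g(1)], of x]
        by (auto simp: choose_wins_le_def)
    qed
  qed
  then have "\<exists>d\<in>Field g. r \<le>o |Pow (underS g d)|"
    using Sigma_Pow_underS_ordLess[OF r g(2)]
    by (auto simp: ordLess_iff_not_ordLeq_card[OF regular_uncountable_Card_order[OF r]])
  then show ?thesis
    by (rule iffD2[OF ordLeq_two_pow_less_iff[OF r g]])
qed

lemma ordLeq_imp_Cut_ws_eq:
  assumes I: "monotone_family (Field r) I" "\<forall>x\<in>Field r. {x} \<in> I"
    and le: "r \<le>o |Pow (Field g)|"
  shows "Cut_has_ws (Field r) g (choose_wins_eq (Field r) I g)"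
proof -
  have "Field r \<noteq> {}"
    using regular_uncountable_infinite_Field[OF r] by auto
  then obtain \<sigma> :: "('b, 'a) cut_strategy" where "is_cut_strategy (Field r) g \<sigma>"
    and single: "\<And>p. is_play (Field r) g p \<Longrightarrow> follows g \<sigma> p \<Longrightarrow>
       \<exists>x\<in>Field r. choices_Int (Field r) p (Field g) \<subseteq> {x}"
    using separating_strategy[OF regular_uncountable_Card_order[OF r] _ le subset_refl] by blast
  moreover have "\<not> choose_wins_eq (Field r) I g p"
    if p: "is_play (Field r) g p" "follows g \<sigma> p" for p
  proof -
    obtain x where x: "x \<in> Field r" "choices_Int (Field r) p (Field g) \<subseteq> {x}"
      using single[OF p] by (elim bexE)
    then show ?thesis
      using subset_singleton_imp_not_positive[OF I(1) bspec[OF I(2) x(1)] x(2)]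
      by (simp add: choose_wins_eq_def)
  qed
  ultimately show ?thesis
    unfolding Cut_has_ws_def by blast
qed

lemma ordLeq_imp_Cut_ws_le:
  assumes I: "monotone_family (Field r) I" "\<forall>x\<in>Field r. {x} \<in> I"
    and le: "r \<le>o two_pow_less g"
  shows "Cut_has_ws (Field r) g (choose_wins_le (Field r) I g)"
proof -
  obtain d where d: "d \<in> Field g" "r \<le>o |Pow (underS g d)|"
    using iffD1[OF ordLeq_two_pow_less_iff[OF r g] le] by (elim bexE)
  have "Field r \<noteq> {}"
    using regular_uncountable_infinite_Field[OF r] by auto
  then obtain \<sigma> :: "('b, 'a) cut_strategy" where "is_cut_strategy (Field r) g \<sigma>"
    and single: "\<And>p. is_play (Field r) g p \<Longrightarrow> follows g \<sigma> p \<Longrightarrow>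
       \<exists>x\<in>Field r. choices_Int (Field r) p (underS g d) \<subseteq> {x}"
    using separating_strategy[OF regular_uncountable_Card_order[OF r] _ d(2) underS_subset_Field] by blast
  moreover have "\<not> choose_wins_le (Field r) I g p"
    if p: "is_play (Field r) g p" "follows g \<sigma> p" for p
  proof -
    obtain x where x: "x \<in> Field r" "choices_Int (Field r) p (underS g d) \<subseteq> {x}"
      using single[OF p] by (elim bexE)
    have "choices_Int (Field r) p (underS g d) \<notin> positive (Field r) I"
      by (rule subset_singleton_imp_not_positive[OF I(1) bspec[OF I(2) x(1)] x(2)])
    then show ?thesis
      using d(1) by (auto simp: choose_wins_le_def)
  qed
  ultimately show ?thesis
    unfolding Cut_has_ws_def by blast
qed

end

lemma Cut_ws_less_imp_ws_le:
  assumes "Cut_has_ws K g (choose_wins_less K I g)"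
  shows "Cut_has_ws K g (choose_wins_le K I g)"
  using assms unfolding Cut_has_ws_def choose_wins_le_def choose_wins_less_def by blast

section \<open>The game of length \<open>\<kappa>\<close> and weak compactness\<close>

text \<open>
  Cut plays a colouring \<open>f\<close> without large homogeneous sets. In round \<open>i\<close> the cut is according to the
  colours \<open>f {a i, y}\<close>, where \<open>a i\<close> is a point of the current intersection above \<open>i\<close>. Later points \<open>a j\<close> lie in
  the piece chosen in round \<open>i\<close>, so \<open>f {a i, a j}\<close> depends on \<open>i\<close> only. The points \<open>a i\<close> may
  repeat; since \<open>i \<le> a i\<close>, cofinally many of them still give a cofinal set, which has full size because
  \<open>\<kappa>\<close> is regular. So \<open>a i\<close> can be read off from the current position without recursion on the earlier
  points.
\<close>

lemma not_weakly_compact_imp_Cut_ws: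
  assumes r: "regular_uncountable r" and not_wc: "\<not> weakly_compact r"
  shows "Cut_has_ws (Field r) r (choose_wins_less (Field r) (bd r) r)"
proof -
  have Well: "Well_order r" and reg: "regularCard r"
    using r by (auto simp: regular_uncountable_def card_order_on_def)
  interpret wo: wo_rel r
    by unfold_locales (fact Well)
  obtain f :: "'a set \<Rightarrow> bool" where f:
    "\<And>H b. H \<subseteq> Field r \<Longrightarrow> |H| =o r \<Longrightarrow> \<exists>X\<in>nsets H 2. f X \<noteq> b"
    using r not_wc unfolding weakly_compact_def regular_uncountable_def by metis
  define point :: "'a \<Rightarrow> ('a, 'a) play \<Rightarrow> 'a" where
    "point i h = (SOME y. y \<in> choices_Int (Field r) h (underS r i) \<and> (i, y) \<in> r)" for i h
  define \<sigma> :: "('a, 'a) cut_strategy" where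
    "\<sigma> i h = ({y\<in>Field r. f {point i h, y}}, {y\<in>Field r. \<not> f {point i h, y}})" for i h
  have "\<not> choose_wins_less (Field r) (bd r) r p"
    if p: "is_play (Field r) r p" "follows r \<sigma> p" for p
  proof
    assume win: "choose_wins_less (Field r) (bd r) r p"
    define X where "X i = choices_Int (Field r) p (underS r i)" for i
    define a where "a i = point i (restrict p (underS r i))" for i
    have a: "a i \<in> X i \<and> (i, a i) \<in> r" if i: "i \<in> Field r" for i
    proof -
      have "cofinal (X i) r"
        using win i unfolding choose_wins_less_def X_def positive_bd_iff_cofinal[OF Well] by blast
      then have "\<exists>y. y \<in> X i \<and> (i, y) \<in> r"
        using i unfolding cofinal_def by blast
      moreover have "choices_Int (Field r) (restrict p (underS r i)) (underS r i) = X i"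
        by (simp add: choices_Int_def X_def)
      ultimately show ?thesis
        unfolding a_def point_def by simp (rule someI_ex)
    qed
    define c where "c i \<longleftrightarrow> snd (p i) = {y\<in>Field r. f {a i, y}}" for i
    have colour: "f {a i, y} = c i" if i: "i \<in> Field r" and y: "y \<in> snd (p i)" for i y
    proof -
      have "fst (p i) = ({y\<in>Field r. f {a i, y}}, {y\<in>Field r. \<not> f {a i, y}})"
        using p(2) i unfolding follows_def by (simp add: \<sigma>_def a_def)
      then show ?thesis
        using p(1) i y unfolding is_play_def c_def by auto
    qed
    have later: "f {a i, a j} = c i" if "i \<in> underS r j" "j \<in> Field r" for i j
      using that a[of j] underS_subset_Field[of r j]
      by (intro colour) (auto simp: X_def choices_Int_def)
    obtain b where b: "cofinal {i\<in>Field r. c i = b} r"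
    proof (rule ccontr)
      assume "\<not> thesis"
      then have "\<not> cofinal {i\<in>Field r. c i = True} r" "\<not> cofinal {i\<in>Field r. c i = False} r"
        using that by blast+
      then obtain u v where uv: "u \<in> Field r" "v \<in> Field r"
        "\<forall>i\<in>Field r. c i \<longrightarrow> (i, u) \<in> r" "\<forall>i\<in>Field r. \<not> c i \<longrightarrow> (i, v) \<in> r"
        using not_cofinal_iff_bounded[OF Well, of "{i\<in>Field r. c i = True}"]
          not_cofinal_iff_bounded[OF Well, of "{i\<in>Field r. c i = False}"] by auto
      define w where "w = wo.max2 u v"
      have w: "w \<in> Field r" "(u, w) \<in> r" "(v, w) \<in> r"
        using uv wo.max2_greater_among[of u v] wo.max2_among[of u v] unfolding w_def by auto
      then obtain z where z: "z \<in> Field r" "w \<noteq> z" "(w, z) \<in> r"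
        using infinite_Card_order_limit[of r w] r regular_uncountable_infinite_Field[OF r]
        by (auto simp: regular_uncountable_def)
      then have "(z, w) \<in> r"
        using uv w wo.TRANS by (meson transD)
      then show False
        using z wo.ANTISYM by (auto dest: antisymD)
    qed
    define H where "H = a ` {i\<in>Field r. c i = b}"
    have H: "H \<subseteq> Field r"
      using a by (auto simp: H_def X_def choices_Int_def)
    have "cofinal H r"
      unfolding cofinal_def
    proof
      fix u assume "u \<in> Field r"
      then obtain i where i: "i \<in> Field r" "c i = b" "u \<noteq> i" "(u, i) \<in> r"
        using b unfolding cofinal_def by blast
      then have "(i, a i) \<in> r"
        using a by blast
      then have "(u, a i) \<in> r" "u \<noteq> a i"
        using i wo.TRANS wo.ANTISYM by (auto dest: transD antisymD)
      then show "\<exists>x\<in>H. u \<noteq> x \<and> (u, x) \<in> r"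
        using i by (auto simp: H_def)
    qed
    then have "|H| =o r"
      using reg H by (auto simp: regularCard_def)
    then obtain Y where Y: "Y \<in> nsets H 2" "f Y \<noteq> b"
      using f[OF H, of b] by auto
    then obtain i j where ij: "i \<in> Field r" "j \<in> Field r" "c i = b" "c j = b"
        "a i \<noteq> a j" "Y = {a i, a j}"
      by (auto simp: H_def elim!: nsets2_E)
    then have "i \<in> underS r j \<or> j \<in> underS r i"
      using wo.TOTALS by (auto simp: underS_def)
    then show False
      using later[of i j] later[of j i] ij Y(2) by (auto simp: insert_commute)
  qed
  moreover have "is_cut_strategy (Field r) r \<sigma>"
    by (auto simp: is_cut_strategy_def cuts_def \<sigma>_def)
  ultimately show ?thesis
    unfolding Cut_has_ws_def by blast
qed

text \<open>
  The plays \<open>P x\<close> converge as \<open>x\<close> runs through a homogeneous set \<open>H\<close> for the lexicographic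
  comparison of choice sequences. Suppose that all rounds before \<open>i\<close> have stabilised. There are fewer than
  \<open>\<kappa>\<close> of them, so by regularity they are constant together on an end segment of \<open>H\<close>. On it, the
  comparison of two plays is first decided at round \<open>i\<close> or later, so homogeneity makes the choice
  in round \<open>i\<close> monotone in \<open>x\<close>; a monotone sequence of bits changes at most once. The limit play
  follows the strategy because each of its proper initial segments agrees with some \<open>P x\<close>.
\<close>

lemma weakly_compact_imp_not_Cut_ws:
  assumes r: "regular_uncountable r" and wc: "weakly_compact r"
  shows "\<not> Cut_has_ws (Field r) r (choose_wins_less (Field r) (bd r) r)"
proof
  assume "Cut_has_ws (Field r) r (choose_wins_less (Field r) (bd r) r)"
  then obtain \<sigma> where \<sigma>: "is_cut_strategy (Field r) r \<sigma>"
    and win: "\<And>p. is_play (Field r) r p \<Longrightarrow> follows r \<sigma> p \<Longrightarrow>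
      \<not> choose_wins_less (Field r) (bd r) r p"
    unfolding Cut_has_ws_def by blast
  have Card: "Card_order r" and Well: "Well_order r"
    using r by (auto simp: regular_uncountable_def card_order_on_def)
  interpret wo: wo_rel r
    by unfold_locales (fact Well)
  define P where "P = play_toward r \<sigma>"
  define s where "s x i \<longleftrightarrow> i \<in> choice_pattern r \<sigma> x" for x i
  \<comment> \<open>In the lexicographic order that puts the first piece above the second, \<open>x\<close> is strictly above \<open>y\<close>.\<close>
  define lex where "lex x y \<longleftrightarrow>
    (\<exists>i\<in>Field r. (\<forall>j\<in>underS r i. P x j = P y j) \<and> s x i \<and> \<not> s y i)" for x y
  define f :: "'a set \<Rightarrow> bool" where
    "f X \<longleftrightarrow> (\<exists>x y. X = {x, y} \<and> x \<noteq> y \<and> (x, y) \<in> r \<and> lex x y)" for X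
  obtain H b where H: "H \<subseteq> Field r" "|H| =o r" and hom: "\<forall>X\<in>nsets H 2. f X = b"
    using wc unfolding weakly_compact_def by blast
  have cof: "cofinal H r"
    using full_size_imp_cofinal[OF Card regular_uncountable_infinite_Field[OF r] H] .
  have lex: "lex x y = b" if "x \<in> H" "y \<in> H" "x \<noteq> y" "(x, y) \<in> r" for x y
  proof -
    have "f {x, y} = lex x y"
      unfolding f_def using that wo.ANTISYM by (auto simp: doubleton_eq_iff dest: antisymD)
    then show ?thesis
      using hom that by simp
  qed
  have s_cong: "s x i = s y i" if "P x i = P y i" "x \<in> Field r" "y \<in> Field r" "i \<in> Field r" for x y i
  proof -
    have "x \<in> snd (P x i)" "y \<in> snd (P y i)"
      using mem_snd_play_toward[OF Well \<sigma> that(4)] that(2,3) unfolding P_def by blast+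
    moreover have "snd (P x i) \<in> {fst (fst (P x i)), snd (fst (P x i))}"
      "fst (fst (P x i)) \<inter> snd (fst (P x i)) = {}"
      using bspec[OF is_play_play_toward[OF Well \<sigma>, of x, unfolded is_play_def] that(4)]
      by (auto simp: P_def cuts_def)
    ultimately show ?thesis
      using that(1) unfolding s_def choice_pattern_def P_def by auto
  qed
  have mono: "if b then s y i \<longrightarrow> s x i else s x i \<longrightarrow> s y i"
    if xy: "x \<in> H" "y \<in> H" "x \<noteq> y" "(x, y) \<in> r" and i: "i \<in> Field r"
      and agree: "\<forall>j\<in>underS r i. P x j = P y j" for x y i
  proof (cases b)
    case True
    then obtain k where k: "k \<in> Field r" "\<forall>j\<in>underS r k. P x j = P y j" "s x k" "\<not> s y k"
      using lex[OF xy] unfolding lex_def by blast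
    consider "k \<in> underS r i" | "k = i" | "i \<in> underS r k"
      using k(1) i wo.TOTALS by (auto simp: underS_def)
    then show ?thesis
    proof cases
      case 1
      then show ?thesis
        using agree k s_cong[of x k y] xy H by blast
    next
      case 3
      then show ?thesis
        using k s_cong[of x i y] xy H i by auto
    qed (use True k in auto)
  next
    case False
    then show ?thesis
      using lex[OF xy] i agree unfolding lex_def by auto
  qed
  have settle: "\<exists>q. \<exists>a\<in>Field r. \<forall>x\<in>H. (a, x) \<in> r \<longrightarrow> P x i = q" if "i \<in> Field r" for i
    using wo.WF that
  proof (induction i)
    case (less i)
    have "\<exists>q a. a \<in> Field r \<and> (\<forall>x\<in>H. (a, x) \<in> r \<longrightarrow> P x j = q)" if "j \<in> underS r i" for j
    proof -
      have "(j, i) \<in> r - Id" "j \<in> Field r"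
        using that underS_subset_Field[of r i] by (auto simp: underS_def)
      then show ?thesis
        using less.IH[of j] by blast
    qed
    then obtain q e where qe: "\<And>j. j \<in> underS r i \<Longrightarrow>
        e j \<in> Field r \<and> (\<forall>x\<in>H. (e j, x) \<in> r \<longrightarrow> P x j = q j)"
      by metis
    have "|e ` underS r i| <o r"
      using card_of_underS[OF Card less.prems] card_of_image ordLeq_ordLess_trans by blast
    moreover have "e ` underS r i \<subseteq> Field r"
      using qe by (auto simp del: split_paired_All)
    ultimately obtain a where a: "a \<in> Field r" "\<forall>u\<in>e ` underS r i. (u, a) \<in> r"
      using small_imp_bounded[OF r] by metis
    have settled: "P x j = q j" if "x \<in> H" "(a, x) \<in> r" "j \<in> underS r i" for x j
    proof -
      have "(e j, a) \<in> r"
        using a(2) that(3) by simp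
      then have "(e j, x) \<in> r"
        using that(2) by (rule transD[OF wo.TRANS])
      then show ?thesis
        using qe[OF that(3)] that(1) by simp
    qed
    have agree: "\<forall>j\<in>underS r i. P x j = P y j"
      if "x \<in> H" "y \<in> H" "(a, x) \<in> r" "(a, y) \<in> r" for x y
      using that settled by simp
    \<comment> \<open>Monotonicity preserves the bit \<open>\<not> b\<close>: past a point having it, the bit is constantly \<open>\<not> b\<close>,
      and without such a point it is constantly \<open>b\<close>.\<close>
    obtain z where z: "z \<in> H" "(a, z) \<in> r"
      "\<forall>x\<in>H. (z, x) \<in> r \<longrightarrow> s x i = s z i"
    proof (cases "\<exists>z\<in>H. (a, z) \<in> r \<and> s z i = (\<not> b)")
      case True
      then obtain z where z: "z \<in> H" "(a, z) \<in> r" "s z i = (\<not> b)"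
        by blast
      have "s x i = s z i" if x: "x \<in> H" "(z, x) \<in> r" for x
      proof (cases "x = z")
        case False
        have "(a, x) \<in> r"
          using z(2) x(2) wo.TRANS by (meson transD)
        then show ?thesis
          using mono[OF z(1) x(1) _ x(2) less.prems] agree[of z x] z x False
          by (auto split: if_splits)
      qed simp
      with z that show ?thesis
        by blast
    next
      case False
      obtain z where z: "z \<in> H" "(a, z) \<in> r"
        using cof a(1) unfolding cofinal_def by blast
      have "s x i = s z i" if "x \<in> H" "(z, x) \<in> r" for x
        using False z that wo.TRANS by (metis transD)
      with z that show ?thesis
        by blast
    qed
    have "P x i = P z i" if x: "x \<in> H" "(z, x) \<in> r" for x
    proof -
      have "(a, x) \<in> r"
        using z(2) x(2) wo.TRANS by (meson transD)
      then show ?thesis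
        using agree[of x z] z x unfolding P_def s_def
        by (intro play_toward_step_cong[OF Well]) auto
    qed
    then show ?case
      using z(1) H(1) by blast
  qed
  then obtain p a where pa: "\<And>i. i \<in> Field r \<Longrightarrow>
      a i \<in> Field r \<and> (\<forall>x\<in>H. (a i, x) \<in> r \<longrightarrow> P x i = p i)"
    by metis
  have tail: "\<exists>u\<in>Field r. \<forall>x\<in>H. (u, x) \<in> r \<longrightarrow> (\<forall>j\<in>R. P x j = p j)"
    if R: "R \<subseteq> Field r" "|R| <o r" for R
  proof -
    have "|a ` R| <o r"
      using R(2) card_of_image ordLeq_ordLess_trans by blast
    moreover have "a ` R \<subseteq> Field r"
      using pa R(1) by (auto simp del: split_paired_All)
    ultimately obtain u where u: "u \<in> Field r" "\<forall>v\<in>a ` R. (v, u) \<in> r"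
      using small_imp_bounded[OF r] by metis
    have "P x j = p j" if "x \<in> H" "(u, x) \<in> r" "j \<in> R" for x j
    proof -
      have "(a j, u) \<in> r"
        using u(2) that(3) by simp
      then have "(a j, x) \<in> r"
        using that(2) by (rule transD[OF wo.TRANS])
      then show ?thesis
        using pa[of j] that R(1) by blast
    qed
    with u(1) show ?thesis
      by blast
  qed
  \<comment> \<open>The round \<open>i\<close> is included, so that the segment below it and the move in it come from one play.\<close>
  have round: "\<exists>x\<in>H. (\<forall>j\<in>underS r i. P x j = p j) \<and> P x i = p i" if i: "i \<in> Field r" for i
  proof -
    have "|insert i (underS r i)| <o r"
    proof -
      obtain k where k: "k \<in> Field r" "i \<noteq> k" "(i, k) \<in> r"
        using infinite_Card_order_limit[OF Card regular_uncountable_infinite_Field[OF r] i] by blast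
      have "insert i (underS r i) \<subseteq> underS r k"
        using k wo.TRANS wo.ANTISYM by (auto simp: underS_def dest: transD antisymD)
      then show ?thesis
        using card_of_underS[OF Card k(1)] card_of_mono1 ordLeq_ordLess_trans by blast
    qed
    then obtain u where "u \<in> Field r"
      "\<forall>x\<in>H. (u, x) \<in> r \<longrightarrow> (\<forall>j\<in>insert i (underS r i). P x j = p j)"
      using tail[of "insert i (underS r i)"] i underS_subset_Field[of r i] by auto
    then show ?thesis
      using cof unfolding cofinal_def by blast
  qed
  have "is_play (Field r) r p"
    unfolding is_play_def
  proof
    fix i assume i: "i \<in> Field r"
    then obtain x where "P x i = p i"
      using round by blast
    then show "fst (p i) \<in> cuts (Field r) \<and> snd (p i) \<in> {fst (fst (p i)), snd (fst (p i))}"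
      using is_play_play_toward[OF Well \<sigma>, of x] i unfolding is_play_def P_def by metis
  qed
  moreover have "follows r \<sigma> p"
    unfolding follows_def
  proof
    fix i assume i: "i \<in> Field r"
    then obtain x where x: "\<forall>j\<in>underS r i. P x j = p j" "P x i = p i"
      using round by blast
    then have "restrict (P x) (underS r i) = restrict p (underS r i)"
      by (auto simp: restrict_def)
    then show "fst (p i) = \<sigma> i (restrict p (underS r i))"
      using fst_play_toward[OF Well, of \<sigma> x i] x(2) unfolding P_def by metis
  qed
  moreover have "choose_wins_less (Field r) (bd r) r p"
    unfolding choose_wins_less_def
  proof
    fix d assume d: "d \<in> Field r"
    obtain u where u: "u \<in> Field r" "\<forall>x\<in>H. (u, x) \<in> r \<longrightarrow> (\<forall>j\<in>underS r d. P x j = p j)"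
      using tail[OF underS_subset_Field card_of_underS[OF Card d]] by blast
    have mem: "x \<in> choices_Int (Field r) p (underS r d)" if "x \<in> H" "(u, x) \<in> r" for x
      using mem_choices_Int_play_toward[OF Well \<sigma> underS_subset_Field, of x d] that u(2) H(1)
      unfolding choices_Int_def P_def by auto
    have "cofinal (choices_Int (Field r) p (underS r d)) r"
      unfolding cofinal_def
    proof
      fix v assume v: "v \<in> Field r"
      define w where "w = wo.max2 u v"
      have w: "w \<in> Field r" "(u, w) \<in> r" "(v, w) \<in> r"
        using u(1) v wo.max2_greater_among[of u v] wo.max2_among[of u v] unfolding w_def by auto
      then obtain x where x: "x \<in> H" "w \<noteq> x" "(w, x) \<in> r"
        using cof unfolding cofinal_def by blast
      then have "(u, x) \<in> r" "(v, x) \<in> r" "v \<noteq> x"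
        using w wo.TRANS wo.ANTISYM by (auto dest: transD antisymD)
      then show "\<exists>x\<in>choices_Int (Field r) p (underS r d). v \<noteq> x \<and> (v, x) \<in> r"
        using mem x by blast
    qed
    then show "choices_Int (Field r) p (underS r d) \<in> positive (Field r) (bd r)"
      unfolding positive_bd_iff_cofinal[OF Well] by (simp add: choices_Int_def)
  qed
  ultimately show False
    using win by blast
qed

theorem mainTheorem6:
  fixes r :: "'a rel" and g :: "'b rel" and I :: "'a set set"
  assumes kappa: "regular_uncountable r"
    and gamma: "limit_ordinal g" "g <o r"
    and I_mono: "monotone_family (Field r) I"
    and I_union: "\<not> (\<exists>F. F \<subseteq> I \<and> |F| <o r \<and> \<Union>F = Field r)"
  shows
    "((Cut_has_ws (Field r) g (choose_wins_eq (Field r) I g) \<longrightarrow> r \<le>o ctwo ^c |Field g| ) \<and>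
      ((\<forall>x\<in>Field r. {x} \<in> I) \<longrightarrow> r \<le>o ctwo ^c |Field g| \<longrightarrow>
         Cut_has_ws (Field r) g (choose_wins_eq (Field r) I g))) \<and>
     ((Cut_has_ws (Field r) g (choose_wins_le (Field r) I g) \<longrightarrow> r \<le>o two_pow_less g) \<and>
      ((\<forall>x\<in>Field r. {x} \<in> I) \<longrightarrow> r \<le>o two_pow_less g \<longrightarrow>
         Cut_has_ws (Field r) g (choose_wins_le (Field r) I g))) \<and>
     (two_pow_less g <o r \<longrightarrow>
         \<not> Cut_has_ws (Field r) g (choose_wins_less (Field r) I g)) \<and>
     (I = bd r \<longrightarrow>
         (Cut_has_ws (Field r) r (choose_wins_less (Field r) I r) \<longleftrightarrow> \<not> weakly_compact r))"
proof -
  have Well: "Well_order g"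
    using gamma(1) by (simp add: limit_ordinal_def)
  have "ctwo ^c |Field g| =o |Pow (Field g)|"
    using ctwo_cexp_ordIso_Pow[of "|Field g|"] by (simp add: Field_card_of)
  then have pow: "r \<le>o ctwo ^c |Field g| \<longleftrightarrow> r \<le>o |Pow (Field g)|"
    using ordLeq_ordIso_trans[of r "ctwo ^c |Field g|"] ordIso_symmetric
      ordLeq_ordIso_trans[of r "|Pow (Field g)|"] by auto
  note setting = kappa Well gamma(2) I_union
  have "\<not> r \<le>o two_pow_less g" if "two_pow_less g <o r"
    using that not_ordLess_ordLeq by blast
  then show ?thesis
    using pow Cut_ws_eq_imp_ordLeq[OF setting] ordLeq_imp_Cut_ws_eq[OF setting I_mono]
      Cut_ws_le_imp_ordLeq[OF setting] ordLeq_imp_Cut_ws_le[OF setting I_mono]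
      Cut_ws_less_imp_ws_le[of "Field r" g I]
      not_weakly_compact_imp_Cut_ws[OF kappa] weakly_compact_imp_not_Cut_ws[OF kappa]
    by blast
qed

end
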